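(* Let $n$ be a positive integer, $\tau>0$, $\delta \in (0,1)$, and let $S \subset \mathbb{F}_2^n$ be such that $$|S| > 2^{20}\max\left(\frac{n^4(1+\tau)^4}{(\tau\delta)^8},\, n^4\right),$$ and suppose $$n \geq 5\left\lceil \log_2\left(\max\left(\frac{n(1+\tau)}{(\tau\delta)^2},\, n\right)\right)\right\rceil + 25.$$ Then there exists a natural number $$t \geq \log_2|S| - 4\log_2\left(\max\left(\frac{n(1+\tau)}{(\tau\delta)^2},\, n\right)\right) - 20$$ such that at least a $(1-\delta)$-fraction of all surjective linear maps $L : \mathbb{F}_2^n \to \mathbb{F}_2^t$ are such that $L(U_S)$ is $\tau 2^{-t}$-close to uniform in the $\ell_\infty$ norm, i.e. $|\Pr[L(U_S)=y] - 2^{-t}| \leq \tau 2^{-t}$ for all $y \in \mathbb{F}_2^t$.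
   Context: $U_S$ denotes a random variable distributed uniformly on the finite set $S$. A random variable $X$ on a finite set $Y$ is $\epsilon$-close to uniform in the $\ell_\infty$ norm if $|\Pr[X=y] - 1/|Y|| \leq \epsilon$ for every $y \in Y$. *)

theory Defs
  imports Complex_Main
begin

definition F2vec :: "nat \<Rightarrow> (nat \<Rightarrow> bool) set" where
  "F2vec n = {v. \<forall>i. n \<le> i \<longrightarrow> \<not> v i}"

definition vadd :: "(nat \<Rightarrow> bool) \<Rightarrow> (nat \<Rightarrow> bool) \<Rightarrow> (nat \<Rightarrow> bool)" where
  "vadd x y = (\<lambda>i. x i \<noteq> y i)"

definition vscale :: "bool \<Rightarrow> (nat \<Rightarrow> bool) \<Rightarrow> (nat \<Rightarrow> bool)" where
  "vscale c x = (\<lambda>i. c \<and> x i)"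

text \<open>F_2-linear maps F_2^n \<rightarrow> F_2^t, represented extensionally (undefined outside F_2^n)
  so that the set of such maps is finite.\<close>
definition F2linear :: "nat \<Rightarrow> nat \<Rightarrow> ((nat \<Rightarrow> bool) \<Rightarrow> (nat \<Rightarrow> bool)) set" where
  "F2linear n t = {L. (\<forall>x\<in>F2vec n. L x \<in> F2vec t)
      \<and> (\<forall>x. x \<notin> F2vec n \<longrightarrow> L x = undefined)
      \<and> (\<forall>x\<in>F2vec n. \<forall>y\<in>F2vec n. L (vadd x y) = vadd (L x) (L y))
      \<and> (\<forall>c. \<forall>x\<in>F2vec n. L (vscale c x) = vscale c (L x))}"

definition F2surj_linear :: "nat \<Rightarrow> nat \<Rightarrow> ((nat \<Rightarrow> bool) \<Rightarrow> (nat \<Rightarrow> bool)) set" where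
  "F2surj_linear n t = {L \<in> F2linear n t. L ` F2vec n = F2vec t}"

definition prob_image :: "((nat \<Rightarrow> bool) \<Rightarrow> (nat \<Rightarrow> bool)) \<Rightarrow> (nat \<Rightarrow> bool) set \<Rightarrow> (nat \<Rightarrow> bool) \<Rightarrow> real" where
  "prob_image L S y = real (card {x\<in>S. L x = y}) / real (card S)"

definition close_to_uniform :: "real \<Rightarrow> ('a \<Rightarrow> real) \<Rightarrow> 'a set \<Rightarrow> bool" where
  "close_to_uniform eps P Y = (\<forall>y\<in>Y. \<bar>P y - 1 / real (card Y)\<bar> \<le> eps)"

end

theory Submission
  imports Defs "HOL-Analysis.Convex"
begin

text \<open>Put \<open>m = |S| / 2 ^ t\<close> and choose \<open>a\<close> with \<open>n \<le> 2 ^ a \<le> 2 n\<close>. Refine a uniformly random linear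
  \<open>L : F_2^n \<rightarrow> F_2^t\<close> by an independent random linear \<open>R : F_2^n \<rightarrow> F_2^a\<close>. If some bucket
  \<open>L x = y\<close> is off by more than \<open>\<tau> m\<close>, then by Chebyshev applied inside that bucket, with
  probability at least \<open>1/2\<close> over \<open>R\<close> all the cells \<open>(y, c)\<close> of \<open>(L, R)\<close>, \<open>c \<in> F_2^a\<close>, are off
  by a relative error of at least \<open>\<tau> / 2\<close>. On the other hand only a small fraction of all cells is
  off, by the second moment of \<open>(L, R)\<close>. As \<open>(L, R)\<close> and \<open>(L + V R, R)\<close> have the same
  distribution for every \<open>V : F_2^a \<rightarrow> F_2^t\<close>, the cells \<open>(y, c)\<close> may be replaced by
  \<open>(y + V c, c)\<close> with random \<open>V\<close>; splitting off one coordinate of \<open>c\<close> at a time multiplies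
  the densities of the bad sets pairwise, so after \<open>a\<close> steps the existence of a completely bad
  \<open>y\<close> is as unlikely as a single bad cell, up to a factor \<open>2\<close>.\<close>

section \<open>Linear maps over the two-element field\<close>

lemma vadd_simps [simp]:
  "vadd (vadd x y) y = x" "vadd x (\<lambda>_. False) = x" "vadd (\<lambda>_. False) x = x" "vadd x x = (\<lambda>_. False)"
  by (auto simp: vadd_def)

lemma vadd_commute: "vadd x y = vadd y x"
  by (auto simp: vadd_def)

lemma vadd_assoc: "vadd (vadd x y) z = vadd x (vadd y z)"
  by (auto simp: vadd_def)

lemma vadd_left_commute: "vadd x (vadd y z) = vadd y (vadd x z)"
  by (auto simp: vadd_def)

lemmas vadd_ac = vadd_assoc vadd_commute vadd_left_commute

lemma vadd_eq_iff: "vadd x y = z \<longleftrightarrow> x = vadd z y"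
  by (metis vadd_simps(1))

lemma vscale_simps [simp]:
  "vscale False x = (\<lambda>_. False)" "vscale True x = x" "vscale b (\<lambda>_. False) = (\<lambda>_. False)"
  by (auto simp: vscale_def)

lemma vscale_vadd: "vscale b (vadd x y) = vadd (vscale b x) (vscale b y)"
  by (auto simp: vscale_def vadd_def)

lemma zero_in_F2vec [simp]: "(\<lambda>_. False) \<in> F2vec n"
  and vadd_in_F2vec [simp]: "x \<in> F2vec n \<Longrightarrow> y \<in> F2vec n \<Longrightarrow> vadd x y \<in> F2vec n"
  and vscale_in_F2vec [simp]: "x \<in> F2vec n \<Longrightarrow> vscale b x \<in> F2vec n"
  by (auto simp: F2vec_def vadd_def vscale_def)

section \<open>Coordinates and cardinality of F_2^n\<close>

lemma F2vec_0: "F2vec 0 = {\<lambda>_. False}"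
  by (auto simp: F2vec_def)

lemma case_nat_in_F2vec_Suc [simp]: "case_nat b c \<in> F2vec (Suc n) \<longleftrightarrow> c \<in> F2vec n"
  by (auto simp: F2vec_def split: nat.splits)

text \<open>\<open>case_nat b c\<close> puts the bit \<open>b\<close> in front of \<open>c\<close>,
  so this splits off coordinate 0. It is the recursion behind every induction on the dimension
  below.\<close>

lemma F2vec_Suc: "F2vec (Suc n) = case_nat False ` F2vec n \<union> case_nat True ` F2vec n" (is "_ = ?R")
proof
  show "F2vec (Suc n) \<subseteq> ?R"
  proof
    fix x assume x: "x \<in> F2vec (Suc n)"
    have "x = case_nat (x 0) (\<lambda>i. x (Suc i))"
      by (auto split: nat.splits)
    moreover have "(\<lambda>i. x (Suc i)) \<in> F2vec n"
      using x by (auto simp: F2vec_def)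
    ultimately show "x \<in> ?R"
      by (cases "x 0") (force intro: rev_image_eqI)+
  qed
qed auto

lemma inj_case_nat: "inj (case_nat b)"
  by (rule injI) (metis (no_types) ext old.nat.simps(5))

lemma case_nat_disjoint: "case_nat False ` A \<inter> case_nat True ` B = {}"
  by (auto simp: fun_eq_iff split: nat.splits)

lemma finite_F2vec [simp]: "finite (F2vec n)"
  by (induction n) (simp_all add: F2vec_0 F2vec_Suc)

lemma card_F2vec [simp]: "card (F2vec n) = 2 ^ n"
  by (induction n)
     (simp_all add: F2vec_0 F2vec_Suc card_Un_disjoint case_nat_disjoint card_image
        inj_on_subset [OF inj_case_nat])

lemma F2vec_nonempty [simp]: "F2vec n \<noteq> {}"
  using zero_in_F2vec by blast

lemma sum_F2vec_Suc:
  "(\<Sum>c\<in>F2vec (Suc n). f c) = (\<Sum>c\<in>F2vec n. f (case_nat False c) + f (case_nat True c))"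
  unfolding F2vec_Suc
  by (subst sum.union_disjoint)
     (simp_all add: case_nat_disjoint sum.reindex inj_on_subset [OF inj_case_nat] sum.distrib)

text \<open>Resetting the value to \<open>undefined\<close> outside F_2^n keeps the sum in the
  extensional representation of \<open>F2linear\<close>, while \<open>f\<close> may be any function
  given by a formula.\<close>

definition lin_add :: "nat \<Rightarrow> ((nat \<Rightarrow> bool) \<Rightarrow> nat \<Rightarrow> bool) \<Rightarrow> ((nat \<Rightarrow> bool) \<Rightarrow> nat \<Rightarrow> bool) \<Rightarrow> (nat \<Rightarrow> bool) \<Rightarrow> nat \<Rightarrow> bool"
  where "lin_add n L f = (\<lambda>x. if x \<in> F2vec n then vadd (L x) (f x) else undefined)"

lemma F2linearD:
  assumes "L \<in> F2linear n t"
  shows "x \<in> F2vec n \<Longrightarrow> L x \<in> F2vec t"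
    and "x \<notin> F2vec n \<Longrightarrow> L x = undefined"
    and "x \<in> F2vec n \<Longrightarrow> y \<in> F2vec n \<Longrightarrow> L (vadd x y) = vadd (L x) (L y)"
    and "x \<in> F2vec n \<Longrightarrow> L (vscale b x) = vscale b (L x)"
  using assms by (auto simp: F2linear_def)

lemma lin_add_in_F2linear:
  assumes "L \<in> F2linear n t"
    and "\<And>x. x \<in> F2vec n \<Longrightarrow> f x \<in> F2vec t"
    and "\<And>x y. x \<in> F2vec n \<Longrightarrow> y \<in> F2vec n \<Longrightarrow> f (vadd x y) = vadd (f x) (f y)"
    and "\<And>b x. x \<in> F2vec n \<Longrightarrow> f (vscale b x) = vscale b (f x)"
  shows "lin_add n L f \<in> F2linear n t"
  using assms unfolding F2linear_def lin_add_def
  by (auto simp: vscale_vadd vadd_ac)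

text \<open>In characteristic two, adding \<open>f\<close> twice changes nothing. Perturbations of
  \<open>L\<close> are therefore involutions, which yields injectivity and bijectivity for
  free.\<close>

lemma lin_add_lin_add:
  assumes "L \<in> F2linear n t"
  shows "lin_add n (lin_add n L f) f = L"
  using F2linearD(2) [OF assms] by (auto simp: lin_add_def)

section \<open>The finite space of linear maps and its collision probabilities\<close>

lemma F2linear_nonempty [simp]: "F2linear n t \<noteq> {}"
proof -
  have "(\<lambda>x. if x \<in> F2vec n then (\<lambda>_. False) else undefined) \<in> F2linear n t"
    by (simp add: F2linear_def)
  then show ?thesis by blast
qed

lemma finite_F2linear [simp]: "finite (F2linear n t)"
proof (rule finite_subset)
  show "F2linear n t \<subseteq> F2vec n \<rightarrow>\<^sub>E F2vec t"
    by (auto simp: F2linear_def)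
qed (simp add: finite_PiE)

lemma card_F2linear_pos [simp]: "card (F2linear n t) > 0"
  by (simp add: card_gt_0_iff)

text \<open>If z_i = 1, then x \<mapsto> x_i y is a linear map sending z to y. Adding it to
  \<open>L\<close> injects the maps with L z = 0 into those with L z = y. The fibre over 0 is thus
  no larger than any of the 2^t disjoint fibres.\<close>

lemma card_F2linear_kernel:
  assumes z: "z \<in> F2vec n" "z \<noteq> (\<lambda>_. False)"
  shows "card {L \<in> F2linear n t. L z = (\<lambda>_. False)} * 2 ^ t \<le> card (F2linear n t)"
proof -
  obtain i where i: "z i" using z(2) by blast
  define K where "K = (\<lambda>y. {L \<in> F2linear n t. L z = y})"
  have "card (K (\<lambda>_. False)) \<le> card (K y)" if y: "y \<in> F2vec t" for y
  proof (rule card_inj_on_le)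
    let ?\<phi> = "\<lambda>L. lin_add n L (\<lambda>x. vscale (x i) y)"
    show "inj_on ?\<phi> (K (\<lambda>_. False))"
      by (rule inj_on_inverseI [where g = ?\<phi>]) (auto simp: K_def intro: lin_add_lin_add)
    have "?\<phi> L \<in> F2linear n t" if "L \<in> F2linear n t" for L
    proof (rule lin_add_in_F2linear [OF that])
      show "vscale (x i) y \<in> F2vec t" for x
        using y by simp
    qed (auto simp: vadd_def vscale_def)
    then show "?\<phi> ` K (\<lambda>_. False) \<subseteq> K y"
      using z i by (auto simp: K_def lin_add_def)
  qed (simp add: K_def)
  then have "(\<Sum>y\<in>F2vec t. card (K (\<lambda>_. False))) \<le> (\<Sum>y\<in>F2vec t. card (K y))"
    by (rule sum_mono)
  also have "\<dots> = card (\<Union>y\<in>F2vec t. K y)"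
    by (rule card_UN_disjoint [symmetric]) (auto simp: K_def)
  also have "\<dots> \<le> card (F2linear n t)"
    by (rule card_mono) (auto simp: K_def)
  finally show ?thesis by (simp add: K_def mult.commute)
qed

lemma card_F2linear_collision:
  assumes "x \<in> F2vec n" "x' \<in> F2vec n" "x \<noteq> x'"
  shows "card {L \<in> F2linear n t. L x = L x'} * 2 ^ t \<le> card (F2linear n t)"
proof -
  have "vadd x x' \<noteq> (\<lambda>_. False)"
    using assms by (auto simp: vadd_def fun_eq_iff)
  moreover have "{L \<in> F2linear n t. L x = L x'} = {L \<in> F2linear n t. L (vadd x x') = (\<lambda>_. False)}"
    using assms by (auto simp: F2linearD(3) vadd_eq_iff)
  ultimately show ?thesis
    using card_F2linear_kernel [of "vadd x x'" n t] assms by simp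
qed

section \<open>Second moments and averages\<close>

text \<open>Variance bound for a 2-universal hash family. The sum of squared bucket sizes counts
  colliding pairs: the diagonal contributes |I| |T|, and the off-diagonal pairs at most |I| |T|^2 /
  |Y|, which is cancelled by the squared mean.\<close>

lemma second_moment:
  fixes h :: "'i \<Rightarrow> 'a \<Rightarrow> 'b"
  assumes fin: "finite I" "finite T" "finite Y" "Y \<noteq> {}"
    and maps: "\<And>i x. i \<in> I \<Longrightarrow> x \<in> T \<Longrightarrow> h i x \<in> Y"
    and coll: "\<And>x x'. x \<in> T \<Longrightarrow> x' \<in> T \<Longrightarrow> x \<noteq> x' \<Longrightarrow>
      card {i \<in> I. h i x = h i x'} * card Y \<le> card I"
  shows "(\<Sum>i\<in>I. \<Sum>y\<in>Y. (real (card {x \<in> T. h i x = y}) - real (card T) / real (card Y))\<^sup>2)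
    \<le> real (card I) * real (card T)"
proof -
  define N where "N = (\<lambda>i y. real (card {x \<in> T. h i x = y}))"
  define \<mu> where "\<mu> = real (card T) / real (card Y)"
  have Y: "real (card Y) > 0" using fin by (simp add: card_gt_0_iff)
  have N: "N i y = (\<Sum>x\<in>T. if h i x = y then 1 else 0)" for i y
    using fin by (simp add: N_def sum.If_cases Int_def)
  have sum_N: "(\<Sum>y\<in>Y. N i y) = card T" if "i \<in> I" for i
    unfolding N using fin maps [OF that] by (subst sum.swap) simp
  have sum_N2: "(\<Sum>y\<in>Y. (N i y)\<^sup>2) = (\<Sum>x\<in>T. \<Sum>x'\<in>T. if h i x = h i x' then 1 else 0)"
    if i: "i \<in> I" for i
  proof -
    have "(\<Sum>y\<in>Y. (N i y)\<^sup>2)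
      = (\<Sum>y\<in>Y. \<Sum>x\<in>T. \<Sum>x'\<in>T. if h i x = y then if h i x = h i x' then 1 else 0 else 0)"
      unfolding N power2_eq_square sum_product by (intro sum.cong refl) auto
    also have "\<dots> = (\<Sum>x\<in>T. \<Sum>x'\<in>T. \<Sum>y\<in>Y. if h i x = y then if h i x = h i x' then 1 else 0 else 0)"
      by (subst sum.swap, intro sum.cong refl, rule sum.swap)
    also have "\<dots> = (\<Sum>x\<in>T. \<Sum>x'\<in>T. if h i x = h i x' then 1 else 0)"
      using fin maps [OF i] by (intro sum.cong refl) simp
    finally show ?thesis .
  qed
  \<comment> \<open>The term |I| / |Y| is granted to the diagonal too, so that the sum over all
    pairs has a closed form and the cancellation against the mean is exact.\<close>
  have pair: "real (card {i \<in> I. h i x = h i x'}) \<le> (if x = x' then real (card I) else 0) + card I / card Y"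
    if "x \<in> T" "x' \<in> T" for x x'
  proof (cases "x = x'")
    case True
    then show ?thesis by simp
  next
    case False
    then have "real (card {i \<in> I. h i x = h i x'} * card Y) \<le> real (card I)"
      using coll that by (intro of_nat_mono) blast
    then show ?thesis using False Y by (simp add: field_simps)
  qed
  have "(\<Sum>i\<in>I. \<Sum>y\<in>Y. (N i y)\<^sup>2) = (\<Sum>x\<in>T. \<Sum>x'\<in>T. real (card {i \<in> I. h i x = h i x'}))"
  proof -
    have "(\<Sum>i\<in>I. \<Sum>y\<in>Y. (N i y)\<^sup>2)
      = (\<Sum>i\<in>I. \<Sum>x\<in>T. \<Sum>x'\<in>T. if h i x = h i x' then 1 else 0)"
      by (intro sum.cong refl sum_N2)
    also have "\<dots> = (\<Sum>x\<in>T. \<Sum>x'\<in>T. \<Sum>i\<in>I. if h i x = h i x' then 1 else 0)"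
      by (subst sum.swap, intro sum.cong refl, rule sum.swap)
    finally show ?thesis using fin by (simp add: sum.If_cases Int_def)
  qed
  also have "\<dots> \<le> (\<Sum>x\<in>T. \<Sum>x'\<in>T. (if x = x' then real (card I) else 0) + card I / card Y)"
    by (intro sum_mono pair)
  also have "\<dots> = card T * (card I + card T * (card I / card Y))"
    using fin by (simp add: sum.distrib)
  finally have *: "(\<Sum>i\<in>I. \<Sum>y\<in>Y. (N i y)\<^sup>2) \<le> card I * (card T + card T * \<mu>)"
    by (simp add: \<mu>_def algebra_simps)
  have "(\<Sum>i\<in>I. \<Sum>y\<in>Y. (N i y - \<mu>)\<^sup>2) = (\<Sum>i\<in>I. (\<Sum>y\<in>Y. (N i y)\<^sup>2) - card T * \<mu>)"
  proof (rule sum.cong [OF refl])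
    fix i assume "i \<in> I"
    have "(\<Sum>y\<in>Y. (N i y - \<mu>)\<^sup>2) = (\<Sum>y\<in>Y. (N i y)\<^sup>2) - 2 * \<mu> * (\<Sum>y\<in>Y. N i y) + card Y * \<mu>\<^sup>2"
      by (simp add: power2_diff sum.distrib sum_subtractf sum_distrib_left mult.commute mult.left_commute)
    also have "card Y * \<mu>\<^sup>2 = card T * \<mu>"
      using Y by (simp add: \<mu>_def power2_eq_square)
    finally show "(\<Sum>y\<in>Y. (N i y - \<mu>)\<^sup>2) = (\<Sum>y\<in>Y. (N i y)\<^sup>2) - card T * \<mu>"
      using sum_N [OF \<open>i \<in> I\<close>] by simp
  qed
  also have "\<dots> \<le> card I * card T"
    using * by (simp add: sum_subtractf algebra_simps)
  finally show ?thesis by (simp add: N_def \<mu>_def)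
qed

section \<open>Uniform averages\<close>

definition mean :: "'a set \<Rightarrow> ('a \<Rightarrow> real) \<Rightarrow> real"
  where "mean A f = (\<Sum>x\<in>A. f x) / real (card A)"

lemma mean_mono: "(\<And>x. x \<in> A \<Longrightarrow> f x \<le> g x) \<Longrightarrow> mean A f \<le> mean A g"
  by (simp add: mean_def sum_mono divide_right_mono)

lemma mean_cmult: "mean A (\<lambda>x. c * f x) = c * mean A f"
  by (simp add: mean_def sum_distrib_left)

lemma mean_const [simp]: "finite A \<Longrightarrow> A \<noteq> {} \<Longrightarrow> mean A (\<lambda>_. c) = c"
  by (simp add: mean_def)

lemma mean_diff: "mean A (\<lambda>x. f x - g x) = mean A f - mean A g"
  by (simp add: mean_def sum_subtractf diff_divide_distrib)

lemma mean_times: "mean (A \<times> B) (\<lambda>(x, y). f x y) = mean A (\<lambda>x. mean B (f x))"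
  by (simp add: mean_def card_cartesian_product sum.cartesian_product mult.commute
      flip: sum_divide_distrib)

text \<open>Probabilities enter as means of indicators, so that independence, exchange of averages
  and Jensen's inequality all become rules about \<open>mean\<close>.\<close>

lemma mean_of_bool: "finite A \<Longrightarrow> mean A (\<lambda>x. of_bool (P x)) = real (card {x \<in> A. P x}) / real (card A)"
  by (simp add: mean_def of_bool_def sum.If_cases Int_def)

lemma mean_reindex_bij_betw:
  assumes "bij_betw \<phi> A B"
  shows "mean A (\<lambda>x. f (\<phi> x)) = mean B f"
  unfolding mean_def by (simp only: sum.reindex_bij_betw [OF assms] bij_betw_same_card [OF assms])

lemma mean_swap: "mean A (\<lambda>x. mean B (f x)) = mean B (\<lambda>y. mean A (\<lambda>x. f x y))"
proof -
  have "(\<Sum>x\<in>A. \<Sum>y\<in>B. f x y) = (\<Sum>y\<in>B. \<Sum>x\<in>A. f x y)"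
    by (rule sum.swap)
  then show ?thesis
    by (simp add: mean_def mult.commute flip: sum_divide_distrib)
qed

lemma mean_nonneg: "(\<And>x. x \<in> A \<Longrightarrow> f x \<ge> 0) \<Longrightarrow> mean A f \<ge> 0"
  by (simp add: mean_def sum_nonneg)

lemma mean_F2vec_Suc:
  "mean (F2vec (Suc n)) f = mean (F2vec n) (\<lambda>c. (f (case_nat False c) + f (case_nat True c)) / 2)"
  by (simp add: mean_def sum_F2vec_Suc flip: sum_divide_distrib)

text \<open>Jensen's inequality for the concave square root, obtained from Cauchy-Schwarz. For empty
  or infinite \<open>A\<close> both sides are 0, because division by 0 gives 0.\<close>

lemma mean_sqrt_le:
  assumes "\<And>x. x \<in> A \<Longrightarrow> f x \<ge> 0"
  shows "mean A (\<lambda>x. sqrt (f x)) \<le> sqrt (mean A f)"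
proof (rule real_le_rsqrt)
  have "(\<Sum>x\<in>A. sqrt (f x))\<^sup>2 \<le> (\<Sum>x\<in>A. (sqrt (f x))\<^sup>2) * real (card A)"
    by (rule sum_squared_le_sum_of_squares)
  also have "\<dots> = (\<Sum>x\<in>A. f x) * real (card A)"
    using assms by simp
  finally show "(mean A (\<lambda>x. sqrt (f x)))\<^sup>2 \<le> mean A f"
    by (cases "card A = 0") (simp_all add: mean_def power_divide power2_eq_square field_simps)
qed

section \<open>Iterated square roots, that is, powers with exponent 1 / 2^k\<close>

lemma funpow_sqrt_nonneg: "x \<ge> 0 \<Longrightarrow> (sqrt ^^ k) x \<ge> 0"
  by (induction k) auto

lemma funpow_sqrt_mono: "x \<le> y \<Longrightarrow> (sqrt ^^ k) x \<le> (sqrt ^^ k) y"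
  by (induction k) auto

lemma funpow_sqrt_mult: "(sqrt ^^ k) (x * y) = (sqrt ^^ k) x * (sqrt ^^ k) y"
  by (induction k) (auto simp: real_sqrt_mult)

lemma mean_funpow_sqrt_le:
  assumes "\<And>x. x \<in> A \<Longrightarrow> f x \<ge> 0"
  shows "mean A (\<lambda>x. (sqrt ^^ k) (f x)) \<le> (sqrt ^^ k) (mean A f)"
proof (induction k)
  case (Suc k)
  have "mean A (\<lambda>x. (sqrt ^^ Suc k) (f x)) \<le> sqrt (mean A (\<lambda>x. (sqrt ^^ k) (f x)))"
    using assms by (simp add: mean_sqrt_le funpow_sqrt_nonneg)
  also have "\<dots> \<le> (sqrt ^^ Suc k) (mean A f)"
    using Suc by simp
  finally show ?case .
qed simp

text \<open>Spending one of the \<open>Suc k\<close> roots on the product of the two 2^k-th roots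
  turns it into a geometric mean, which is at most the arithmetic mean.\<close>

lemma funpow_sqrt_Suc_mult_le:
  assumes "x \<ge> 0" "y \<ge> 0"
  shows "(sqrt ^^ Suc k) (x * y) \<le> ((sqrt ^^ k) x + (sqrt ^^ k) y) / 2"
  using arith_geo_mean_sqrt [OF funpow_sqrt_nonneg [OF assms(1)] funpow_sqrt_nonneg [OF assms(2)]]
  by (simp add: funpow_sqrt_mult)

text \<open>The 2^k-th root of 2^(-t) is 2^(-t / 2^k). A nonempty subset of F_2^t has density at
  least 2^(-t), so this lets twice the root of the density dominate the indicator of
  nonemptiness.\<close>

lemma half_le_funpow_sqrt:
  assumes "t \<le> 2 ^ k"
  shows "1 / 2 \<le> (sqrt ^^ k) (1 / 2 ^ t)"
proof -
  have "(sqrt ^^ k) ((1 / 2) ^ 2 ^ k) = 1 / 2"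
  proof (induction k)
    case (Suc k)
    have "sqrt ((1 / 2) ^ 2 ^ Suc k) = (1 / 2 :: real) ^ 2 ^ k"
      by (simp add: power_even_eq mult.commute)
    then show ?case
      using Suc by (simp only: funpow_Suc_right o_apply)
  qed simp
  moreover have "(1 / 2 :: real) ^ 2 ^ k \<le> (1 / 2) ^ t"
    using assms by (intro power_decreasing) auto
  ultimately show ?thesis
    by (metis funpow_sqrt_mono power_one_over)
qed

section \<open>Random affine slices\<close>

text \<open>A list of \<open>a\<close> vectors of F_2^t stands for a linear map V : F_2^a
  \<rightarrow> F_2^t by its columns; its value at \<open>c\<close> is \<open>lincomb vs c\<close>.
  A uniform list has independent uniform columns.\<close>

definition tuples :: "'a set \<Rightarrow> nat \<Rightarrow> 'a list set"
  where "tuples A k = {xs. set xs \<subseteq> A \<and> length xs = k}"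

lemma tuples_0: "tuples A 0 = {[]}"
  by (auto simp: tuples_def)

lemma finite_tuples: "finite A \<Longrightarrow> finite (tuples A k)"
  unfolding tuples_def by (rule finite_lists_length_eq)

lemma tuples_nonempty: "x \<in> A \<Longrightarrow> tuples A k \<noteq> {}"
  unfolding tuples_def by (auto intro!: exI [of _ "replicate k x"])

lemma mean_tuples_Suc:
  "mean (tuples A (Suc k)) f = mean A (\<lambda>x. mean (tuples A k) (\<lambda>xs. f (x # xs)))"
proof -
  have "bij_betw (\<lambda>(x, xs). x # xs) (A \<times> tuples A k) (tuples A (Suc k))"
    by (rule bij_betw_byWitness [where f' = "\<lambda>xs. (hd xs, tl xs)"])
       (auto simp: tuples_def length_Suc_conv)
  from mean_reindex_bij_betw [OF this, of f] show ?thesis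
    by (simp add: case_prod_unfold flip: mean_times)
qed

primrec lincomb :: "(nat \<Rightarrow> bool) list \<Rightarrow> (nat \<Rightarrow> bool) \<Rightarrow> nat \<Rightarrow> bool" where
  "lincomb [] c = (\<lambda>_. False)"
| "lincomb (v # vs) c = vadd (vscale (c 0) v) (lincomb vs (\<lambda>i. c (Suc i)))"

lemma lincomb_in_F2vec: "set vs \<subseteq> F2vec t \<Longrightarrow> lincomb vs c \<in> F2vec t"
  by (induction vs arbitrary: c) auto

lemma lincomb_vadd: "lincomb vs (vadd c d) = vadd (lincomb vs c) (lincomb vs d)"
proof (induction vs arbitrary: c d)
  case (Cons v vs)
  have "(\<lambda>i. vadd c d (Suc i)) = vadd (\<lambda>i. c (Suc i)) (\<lambda>i. d (Suc i))"
    by (simp add: vadd_def)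
  then show ?case
    using Cons by (auto simp: vadd_def vscale_def fun_eq_iff)
qed simp

lemma lincomb_vscale: "lincomb vs (vscale b c) = vscale b (lincomb vs c)"
proof (induction vs arbitrary: c)
  case (Cons v vs)
  have "(\<lambda>i. vscale b c (Suc i)) = vscale b (\<lambda>i. c (Suc i))"
    by (simp add: vscale_def)
  then show ?case
    using Cons by (auto simp: vadd_def vscale_def fun_eq_iff)
qed simp

section \<open>Densities of shifted intersections and the slice induction\<close>

lemma real_card_Int: "finite F \<Longrightarrow> real (card (A \<inter> F)) = (\<Sum>x\<in>F. of_bool (x \<in> A))"
  by (simp add: of_bool_def sum.If_cases Int_commute)

text \<open>For a fixed y, the point y + v is uniform when v is. Hence the events y \<in> A and y +
  v \<in> B are independent, and the densities multiply exactly.\<close>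

lemma mean_shift_density:
  "mean (F2vec t) (\<lambda>v. real (card (A \<inter> {y. vadd y v \<in> B} \<inter> F2vec t)) / 2 ^ t)
    = real (card (A \<inter> F2vec t)) / 2 ^ t * (real (card (B \<inter> F2vec t)) / 2 ^ t)"
proof -
  let ?F = "F2vec t"
  have "(\<Sum>v\<in>?F. real (card (A \<inter> {y. vadd y v \<in> B} \<inter> ?F)))
    = (\<Sum>v\<in>?F. \<Sum>y\<in>?F. of_bool (y \<in> A) * of_bool (vadd y v \<in> B))"
    by (simp add: real_card_Int of_bool_conj)
  also have "\<dots> = (\<Sum>y\<in>?F. of_bool (y \<in> A) * (\<Sum>v\<in>?F. of_bool (vadd y v \<in> B)))"
    by (subst sum.swap) (simp only: sum_distrib_left)
  also have "\<dots> = (\<Sum>y\<in>?F. of_bool (y \<in> A) * (\<Sum>v\<in>?F. of_bool (v \<in> B)))"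
  proof (rule sum.cong [OF refl], rule arg_cong2 [where f = "(*)", OF refl])
    fix y assume y: "y \<in> ?F"
    have "bij_betw (vadd y) ?F ?F"
      using y by (intro bij_betw_byWitness [where f' = "vadd y"]) (auto simp: vadd_commute [of y])
    then show "(\<Sum>v\<in>?F. of_bool (vadd y v \<in> B)) = (\<Sum>v\<in>?F. of_bool (v \<in> B) :: real)"
      by (rule sum.reindex_bij_betw)
  qed
  also have "\<dots> = real (card (A \<inter> ?F)) * real (card (B \<inter> ?F))"
    by (simp add: real_card_Int flip: sum_distrib_right)
  finally show ?thesis by (simp add: mean_def flip: sum_divide_distrib)
qed

text \<open>Fixing the first column merges the sets \<open>B c\<close> in pairs and leaves the same
  problem in dimension one less. Each merge costs one more square root, so \<open>j\<close> grows as
  \<open>a\<close> shrinks: \<open>a + j\<close> is invariant, and the base case gets exactly t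
  \<le> 2^j. The induction generalises both \<open>j\<close> and \<open>B\<close>; the application
  has \<open>j = 0\<close>.\<close>

lemma mean_affine_slices_le:
  assumes "t \<le> 2 ^ (a + j)"
  shows "mean (tuples (F2vec t) a)
      (\<lambda>vs. of_bool (\<exists>y\<in>F2vec t. \<forall>c\<in>F2vec a. vadd y (lincomb vs c) \<in> B c))
    \<le> 2 * mean (F2vec a) (\<lambda>c. (sqrt ^^ j) (real (card (B c \<inter> F2vec t)) / 2 ^ t))"
  using assms
proof (induction a arbitrary: j B)
  case 0
  let ?z = "\<lambda>_::nat. False"
  let ?d = "real (card (B ?z \<inter> F2vec t)) / 2 ^ t"
  have "of_bool (\<exists>y\<in>F2vec t. y \<in> B ?z) \<le> 2 * (sqrt ^^ j) ?d"
  proof (cases "\<exists>y\<in>F2vec t. y \<in> B ?z")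
    case True
    then have "card (B ?z \<inter> F2vec t) > 0"
      by (auto simp: card_gt_0_iff)
    then have "1 / 2 ^ t \<le> ?d"
      by (simp add: divide_right_mono)
    then show ?thesis
      using half_le_funpow_sqrt [of t j] funpow_sqrt_mono [of "1 / 2 ^ t" ?d j] 0 True by simp
  qed (simp add: funpow_sqrt_nonneg)
  then show ?case
    by (simp add: mean_def tuples_0 F2vec_0)
next
  case (Suc a)
  let ?F = "F2vec t"
  define dens where "dens = (\<lambda>A. real (card (A \<inter> ?F)) / 2 ^ t)"
  \<comment> \<open>If the first bit of the index is 0, the first column \<open>v\<close> does not
    occur; if it is 1, it shifts the point by \<open>v\<close>. Both memberships together are
    membership in \<open>C v c\<close>.\<close>
  define C where "C = (\<lambda>v c. B (case_nat False c) \<inter> {y. vadd y v \<in> B (case_nat True c)})"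
  have dens_nonneg: "dens A \<ge> 0" for A by (simp add: dens_def)
  have slices: "(\<forall>c\<in>F2vec (Suc a). vadd y (lincomb (v # vs) c) \<in> B c)
    \<longleftrightarrow> (\<forall>c\<in>F2vec a. vadd y (lincomb vs c) \<in> C v c)" for v vs y
    unfolding F2vec_Suc C_def by (auto simp: ball_Un vadd_ac)
  have "mean (tuples ?F (Suc a))
      (\<lambda>vs. of_bool (\<exists>y\<in>?F. \<forall>c\<in>F2vec (Suc a). vadd y (lincomb vs c) \<in> B c))
    = mean ?F (\<lambda>v. mean (tuples ?F a)
      (\<lambda>vs. of_bool (\<exists>y\<in>?F. \<forall>c\<in>F2vec a. vadd y (lincomb vs c) \<in> C v c)))"
    by (simp only: mean_tuples_Suc slices)
  also have "\<dots> \<le> mean ?F (\<lambda>v. 2 * mean (F2vec a) (\<lambda>c. (sqrt ^^ Suc j) (dens (C v c))))"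
    unfolding dens_def by (intro mean_mono Suc.IH) (use Suc.prems in simp)
  also have "\<dots> = 2 * mean (F2vec a) (\<lambda>c. mean ?F (\<lambda>v. (sqrt ^^ Suc j) (dens (C v c))))"
    by (subst mean_cmult, subst mean_swap) (rule refl)
  \<comment> \<open>Jensen moves the average over \<open>v\<close> under the root, where the shift
    lemma evaluates it as a product; the arithmetic-geometric mean inequality then uses up the extra
    root.\<close>
  also have "\<dots> \<le> 2 * mean (F2vec a) (\<lambda>c. (sqrt ^^ Suc j) (mean ?F (\<lambda>v. dens (C v c))))"
    by (intro mult_left_mono mean_mono mean_funpow_sqrt_le dens_nonneg) simp
  also have "\<dots> = 2 * mean (F2vec a)
      (\<lambda>c. (sqrt ^^ Suc j) (dens (B (case_nat False c)) * dens (B (case_nat True c))))"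
    unfolding dens_def C_def by (simp only: mean_shift_density)
  also have "\<dots> \<le> 2 * mean (F2vec a) (\<lambda>c. ((sqrt ^^ j) (dens (B (case_nat False c)))
      + (sqrt ^^ j) (dens (B (case_nat True c)))) / 2)"
    by (intro mult_left_mono mean_mono funpow_sqrt_Suc_mult_le dens_nonneg) simp
  also have "\<dots> = 2 * mean (F2vec (Suc a)) (\<lambda>c. (sqrt ^^ j) (dens (B c)))"
    by (simp only: mean_F2vec_Suc)
  finally show ?case by (simp only: dens_def)
qed

text \<open>The law of (L, R) is invariant under (L, R) \<mapsto> (L + V R, R), so the cells may be
  shifted by a random V. The slice bound then replaces the existence of a completely deviating
  \<open>y\<close> by twice the fraction of deviating cells, and Chebyshev bounds that
  fraction.\<close>

lemma mean_all_slices_deviate_le: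
  assumes S: "S \<subseteq> F2vec n" and t: "t \<le> 2 ^ a" and d: "d > 0"
  defines "dev \<equiv> \<lambda>L R y c.
    d \<le> \<bar>real (card {x \<in> S. L x = y \<and> R x = c}) - real (card S) / 2 ^ (t + a)\<bar>"
  shows "mean (F2linear n t) (\<lambda>L. mean (F2linear n a)
      (\<lambda>R. of_bool (\<exists>y\<in>F2vec t. \<forall>c\<in>F2vec a. dev L R y c)))
    \<le> 2 * real (card S) / (2 ^ (t + a) * d\<^sup>2)"
proof -
  define P where "P = F2linear n t \<times> F2linear n a"
  define N where "N = (\<lambda>(L, R) (y :: nat \<Rightarrow> bool, c :: nat \<Rightarrow> bool). real (card {x \<in> S. L x = y \<and> R x = c}))"
  define \<mu> where "\<mu> = real (card S) / 2 ^ (t + a)"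
  let ?V = "tuples (F2vec t) a"
  have finS: "finite S"
    using S finite_F2vec by (rule finite_subset)
  have P: "finite P" "P \<noteq> {}" "card P > 0"
    by (auto simp: P_def card_cartesian_product)
  have V: "finite ?V" "?V \<noteq> {}"
    by (simp_all add: finite_tuples tuples_nonempty [OF zero_in_F2vec])
  have twist: "mean P (\<lambda>(L, R). of_bool (\<exists>y\<in>F2vec t. \<forall>c\<in>F2vec a. dev L R y c))
      = mean P (\<lambda>(L, R). of_bool (\<exists>y\<in>F2vec t. \<forall>c\<in>F2vec a. dev L R (vadd y (lincomb vs c)) c))"
    if vs: "vs \<in> ?V" for vs
  proof -
    \<comment> \<open>Since \<open>R\<close> is left unchanged, \<phi> is an involution on the
      pairs; it moves the cell (y + V c, c) of (L, R) to the cell (y, c).\<close>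
    define \<phi> where "\<phi> = (\<lambda>(L, R). (lin_add n L (\<lambda>x. lincomb vs (R x)), R))"
    have "lin_add n L (\<lambda>x. lincomb vs (R x)) \<in> F2linear n t"
      if "L \<in> F2linear n t" "R \<in> F2linear n a" for L R
      using that vs
      by (intro lin_add_in_F2linear)
         (auto simp: tuples_def lincomb_in_F2vec F2linearD lincomb_vadd lincomb_vscale)
    then have "bij_betw \<phi> P P"
      by (intro bij_betw_byWitness [where f' = \<phi>]) (auto simp: \<phi>_def P_def lin_add_lin_add)
    note this [THEN mean_reindex_bij_betw, of
      "\<lambda>(L, R). of_bool (\<exists>y\<in>F2vec t. \<forall>c\<in>F2vec a. dev L R y c)", symmetric]
    moreover have "{x \<in> S. lin_add n L (\<lambda>x. lincomb vs (R x)) x = y \<and> R x = c}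
        = {x \<in> S. L x = vadd y (lincomb vs c) \<and> R x = c}" for L R y c
      using S by (auto simp: lin_add_def vadd_eq_iff)
    ultimately show ?thesis
      by (simp add: \<phi>_def case_prod_unfold dev_def)
  qed
  have slices: "mean ?V (\<lambda>vs.
        of_bool (\<exists>y\<in>F2vec t. \<forall>c\<in>F2vec a. vadd y (lincomb vs c) \<in> {y. dev L R y c}))
      \<le> 2 * mean (F2vec a) (\<lambda>c. real (card ({y. dev L R y c} \<inter> F2vec t)) / 2 ^ t)" for L R
    using mean_affine_slices_le [of t a 0 "\<lambda>c. {y. dev L R y c}"] t by simp
  have density: "mean (F2vec a) (\<lambda>c. real (card ({y. dev L R y c} \<inter> F2vec t)) / 2 ^ t)
      \<le> (\<Sum>z\<in>F2vec t \<times> F2vec a. (N (L, R) z - \<mu>)\<^sup>2) / (2 ^ (t + a) * d\<^sup>2)" for L R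
  proof -
    have "(\<Sum>c\<in>F2vec a. real (card ({y. dev L R y c} \<inter> F2vec t)))
        = (\<Sum>c\<in>F2vec a. \<Sum>y\<in>F2vec t. of_bool (dev L R y c))"
      by (simp add: real_card_Int)
    also have "\<dots> \<le> (\<Sum>c\<in>F2vec a. \<Sum>y\<in>F2vec t. (N (L, R) (y, c) - \<mu>)\<^sup>2 / d\<^sup>2)"
    proof (intro sum_mono)
      fix c y
      have "d\<^sup>2 \<le> (N (L, R) (y, c) - \<mu>)\<^sup>2" if "dev L R y c"
        using that d by (simp add: abs_le_square_iff [symmetric] dev_def N_def \<mu>_def)
      then show "of_bool (dev L R y c) \<le> (N (L, R) (y, c) - \<mu>)\<^sup>2 / d\<^sup>2"
        using d by (simp add: of_bool_def le_divide_eq)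
    qed
    also have "\<dots> = (\<Sum>z\<in>F2vec t \<times> F2vec a. (N (L, R) z - \<mu>)\<^sup>2) / d\<^sup>2"
      by (subst sum.swap) (simp add: sum.cartesian_product case_prod_unfold flip: sum_divide_distrib)
    finally show ?thesis
      by (simp add: mean_def power_add field_simps flip: sum_divide_distrib)
  qed
  have moment: "mean P (\<lambda>p. \<Sum>z\<in>F2vec t \<times> F2vec a. (N p z - \<mu>)\<^sup>2) \<le> card S"
  proof -
    \<comment> \<open>The pair (L, R) is treated as one hash function into F_2^t \<times> F_2^a; by
      independence its collision probability is at most 2^(-t) 2^(-a).\<close>
    have "(\<Sum>p\<in>P. \<Sum>z\<in>F2vec t \<times> F2vec a.
        (real (card {x \<in> S. (fst p x, snd p x) = z}) - real (card S) / real (card (F2vec t \<times> F2vec a)))\<^sup>2)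
      \<le> real (card P) * real (card S)"
    proof (rule second_moment)
      fix x x' assume x: "x \<in> S" "x' \<in> S" "x \<noteq> x'"
      have "{p \<in> P. (fst p x, snd p x) = (fst p x', snd p x')}
          = {L \<in> F2linear n t. L x = L x'} \<times> {R \<in> F2linear n a. R x = R x'}"
        by (auto simp: P_def)
      moreover have "card {L \<in> F2linear n t. L x = L x'} * 2 ^ t * (card {R \<in> F2linear n a. R x = R x'} * 2 ^ a)
          \<le> card (F2linear n t) * card (F2linear n a)"
        using x S by (intro mult_le_mono card_F2linear_collision) auto
      ultimately show "card {p \<in> P. (fst p x, snd p x) = (fst p x', snd p x')} * card (F2vec t \<times> F2vec a) \<le> card P"
        by (simp add: card_cartesian_product P_def mult_ac)
    qed (use P finS S in \<open>auto simp: P_def F2linearD\<close>)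
    also have "(\<Sum>p\<in>P. \<Sum>z\<in>F2vec t \<times> F2vec a.
        (real (card {x \<in> S. (fst p x, snd p x) = z}) - real (card S) / real (card (F2vec t \<times> F2vec a)))\<^sup>2)
      = (\<Sum>p\<in>P. \<Sum>z\<in>F2vec t \<times> F2vec a. (N p z - \<mu>)\<^sup>2)"
      by (simp add: N_def \<mu>_def case_prod_unfold card_cartesian_product power_add prod_eq_iff)
    finally show ?thesis
      using P by (simp add: mean_def divide_le_eq mult.commute)
  qed
  have "mean (F2linear n t) (\<lambda>L. mean (F2linear n a)
      (\<lambda>R. of_bool (\<exists>y\<in>F2vec t. \<forall>c\<in>F2vec a. dev L R y c)))
    = mean ?V (\<lambda>vs. mean P (\<lambda>(L, R). of_bool (\<exists>y\<in>F2vec t. \<forall>c\<in>F2vec a. dev L R y c)))"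
    using V by (simp add: P_def mean_times)
  also have "\<dots> \<le> mean ?V (\<lambda>vs. mean P (\<lambda>(L, R).
      of_bool (\<exists>y\<in>F2vec t. \<forall>c\<in>F2vec a. dev L R (vadd y (lincomb vs c)) c)))"
    by (rule mean_mono) (simp only: twist order_refl)
  also have "\<dots> = mean P (\<lambda>(L, R). mean ?V (\<lambda>vs.
      of_bool (\<exists>y\<in>F2vec t. \<forall>c\<in>F2vec a. vadd y (lincomb vs c) \<in> {y. dev L R y c})))"
    by (subst mean_swap) (simp add: case_prod_unfold)
  also have "\<dots> \<le> mean P (\<lambda>(L, R). 2 * mean (F2vec a)
      (\<lambda>c. real (card ({y. dev L R y c} \<inter> F2vec t)) / 2 ^ t))"
    using slices by (intro mean_mono) (simp add: case_prod_unfold)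
  also have "\<dots> \<le> mean P (\<lambda>p. 2 / (2 ^ (t + a) * d\<^sup>2) * (\<Sum>z\<in>F2vec t \<times> F2vec a. (N p z - \<mu>)\<^sup>2))"
  proof (rule mean_mono)
    fix p
    show "(case p of (L, R) \<Rightarrow> 2 * mean (F2vec a)
          (\<lambda>c. real (card ({y. dev L R y c} \<inter> F2vec t)) / 2 ^ t))
        \<le> 2 / (2 ^ (t + a) * d\<^sup>2) * (\<Sum>z\<in>F2vec t \<times> F2vec a. (N p z - \<mu>)\<^sup>2)"
      using mult_left_mono [OF density [of "fst p" "snd p"], of 2] by (simp add: case_prod_unfold)
  qed
  also have "\<dots> = 2 / (2 ^ (t + a) * d\<^sup>2) * mean P (\<lambda>p. \<Sum>z\<in>F2vec t \<times> F2vec a. (N p z - \<mu>)\<^sup>2)"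
    by (rule mean_cmult)
  also have "\<dots> \<le> 2 / (2 ^ (t + a) * d\<^sup>2) * card S"
    by (intro mult_left_mono moment) simp
  finally show ?thesis by simp
qed

text \<open>One deviating cell already forces the sum of squares over all cells to be at least d^2,
  so Markov's inequality applies to the total second moment without a union bound.\<close>

lemma mean_ex_deviation_le:
  assumes T: "T \<subseteq> F2vec n" and d: "d > 0"
  shows "mean (F2linear n a)
      (\<lambda>R. of_bool (\<exists>c\<in>F2vec a. d \<le> \<bar>real (card {x \<in> T. R x = c}) - real (card T) / 2 ^ a\<bar>))
    \<le> real (card T) / d\<^sup>2"
proof -
  define D where "D = (\<lambda>R (c :: nat \<Rightarrow> bool). (real (card {x \<in> T. R x = c}) - real (card T) / 2 ^ a)\<^sup>2)"
  have "(\<Sum>R\<in>F2linear n a. \<Sum>c\<in>F2vec a. D R c) \<le> real (card (F2linear n a)) * real (card T)"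
    using second_moment [of "F2linear n a" T "F2vec a" "\<lambda>R x. R x"] T
      finite_subset [OF T] card_F2linear_collision [of _ n _ a]
    by (simp add: D_def F2linearD subset_iff)
  then have moment: "mean (F2linear n a) (\<lambda>R. \<Sum>c\<in>F2vec a. D R c) \<le> card T"
    by (simp add: mean_def divide_le_eq mult.commute)
  have "mean (F2linear n a)
      (\<lambda>R. of_bool (\<exists>c\<in>F2vec a. d \<le> \<bar>real (card {x \<in> T. R x = c}) - real (card T) / 2 ^ a\<bar>))
    \<le> mean (F2linear n a) (\<lambda>R. 1 / d\<^sup>2 * (\<Sum>c\<in>F2vec a. D R c))"
  proof (rule mean_mono)
    fix R
    have "d\<^sup>2 \<le> (\<Sum>c\<in>F2vec a. D R c)"
      if "c \<in> F2vec a" "d \<le> \<bar>real (card {x \<in> T. R x = c}) - real (card T) / 2 ^ a\<bar>" for c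
    proof -
      have "d\<^sup>2 \<le> D R c"
        using that d by (simp add: abs_le_square_iff [symmetric] D_def)
      also have "\<dots> \<le> (\<Sum>c\<in>F2vec a. D R c)"
        using that by (intro member_le_sum) (auto simp: D_def)
      finally show ?thesis .
    qed
    then show "of_bool (\<exists>c\<in>F2vec a. d \<le> \<bar>real (card {x \<in> T. R x = c}) - real (card T) / 2 ^ a\<bar>)
        \<le> 1 / d\<^sup>2 * (\<Sum>c\<in>F2vec a. D R c)"
      using d by (auto simp: of_bool_def le_divide_eq D_def sum_nonneg)
  qed
  also have "\<dots> = 1 / d\<^sup>2 * mean (F2linear n a) (\<lambda>R. \<Sum>c\<in>F2vec a. D R c)"
    by (rule mean_cmult)
  also have "\<dots> \<le> 1 / d\<^sup>2 * card T"
    by (intro mult_left_mono moment) simp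
  finally show ?thesis by simp
qed

text \<open>The image of a non-surjective map is a proper subgroup and misses at least half of
  F_2^t. Every missed point contributes \<mu>^2 to the second moment of the fibre sizes, where \<mu>
  is their mean 2^n / 2^t.\<close>

lemma card_not_surj_le:
  "real (card (F2linear n t - F2surj_linear n t)) \<le> 2 * 2 ^ t / 2 ^ n * real (card (F2linear n t))"
proof -
  define \<mu> :: real where "\<mu> = 2 ^ n / 2 ^ t"
  define E where "E = (\<lambda>L. \<Sum>y\<in>F2vec t. (real (card {x \<in> F2vec n. L x = y}) - \<mu>)\<^sup>2)"
  have moment: "(\<Sum>L\<in>F2linear n t. E L) \<le> real (card (F2linear n t)) * 2 ^ n"
    using second_moment [of "F2linear n t" "F2vec n" "F2vec t" "\<lambda>L x. L x"]
      card_F2linear_collision [of _ n _ t]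
    by (simp add: E_def \<mu>_def F2linearD)
  have "2 ^ t / 2 * \<mu>\<^sup>2 \<le> E L" if L: "L \<in> F2linear n t - F2surj_linear n t" for L
  proof -
    let ?I = "L ` F2vec n"
    have sub: "?I \<subseteq> F2vec t" using L by (auto simp: F2linearD)
    then obtain y where y: "y \<in> F2vec t" "y \<notin> ?I"
      using L by (auto simp: F2surj_linear_def)
    \<comment> \<open>The coset y + L(F_2^n) of a missed point y is disjoint from the image and has
      the same size.\<close>
    have "vadd y ` ?I \<subseteq> F2vec t - ?I"
    proof -
      have "vadd y (L x) \<notin> ?I" if "x \<in> F2vec n" for x
      proof
        assume "vadd y (L x) \<in> ?I"
        then obtain x' where "x' \<in> F2vec n" "vadd y (L x) = L x'" by auto
        moreover from this have "L (vadd x' x) = vadd (L x') (L x)"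
          using L that by (intro F2linearD(3)) auto
        ultimately have "y = L (vadd x' x)"
          using vadd_eq_iff [of y "L x" "L x'"] by simp
        then show False using y \<open>x' \<in> F2vec n\<close> that by auto
      qed
      then show ?thesis using y sub by auto
    qed
    then have "card ?I \<le> card (F2vec t - ?I)"
      by (metis card_image card_mono finite_Diff finite_F2vec inj_onI vadd_commute vadd_eq_iff)
    moreover have "card (F2vec t - ?I) + card ?I = 2 ^ t"
      using sub by (metis card_F2vec card_Diff_subset card_mono finite_F2vec finite_subset le_add_diff_inverse2)
    ultimately have "2 ^ t \<le> 2 * card (F2vec t - ?I)" by simp
    then have "2 ^ t \<le> 2 * real (card (F2vec t - ?I))"
      by (metis of_nat_le_iff of_nat_mult of_nat_numeral of_nat_power)
    then have "2 ^ t / 2 * \<mu>\<^sup>2 \<le> real (card (F2vec t - ?I)) * \<mu>\<^sup>2"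
      by (intro mult_right_mono) auto
    also have "\<dots> = (\<Sum>y\<in>F2vec t - ?I. (real (card {x \<in> F2vec n. L x = y}) - \<mu>)\<^sup>2)"
    proof -
      have "card {x \<in> F2vec n. L x = y} = 0" if "y \<in> F2vec t - ?I" for y
        using that by auto
      then have "(\<Sum>y\<in>F2vec t - ?I. (real (card {x \<in> F2vec n. L x = y}) - \<mu>)\<^sup>2)
          = (\<Sum>y\<in>F2vec t - ?I. (0 - \<mu>)\<^sup>2)"
        by (intro sum.cong refl) (simp only: of_nat_0)
      then show ?thesis by simp
    qed
    also have "\<dots> \<le> E L"
      unfolding E_def by (intro sum_mono2) auto
    finally show ?thesis .
  qed
  then have "real (card (F2linear n t - F2surj_linear n t)) * (2 ^ t / 2 * \<mu>\<^sup>2)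
      \<le> (\<Sum>L\<in>F2linear n t - F2surj_linear n t. E L)"
    by (rule sum_bounded_below)
  also have "\<dots> \<le> (\<Sum>L\<in>F2linear n t. E L)"
    by (intro sum_mono2) (auto simp: E_def sum_nonneg)
  finally have "real (card (F2linear n t - F2surj_linear n t)) * (2 ^ t / 2 * \<mu>\<^sup>2)
      \<le> real (card (F2linear n t)) * 2 ^ n"
    using moment by linarith
  then show ?thesis
    by (simp add: \<mu>_def field_simps power2_eq_square)
qed

section \<open>Uniformity of random linear maps\<close>

text \<open>A bad \<open>L\<close> makes all cells over some \<open>y\<close> deviate for at least
  half of all \<open>R\<close>. Its indicator is therefore at most twice the conditional probability
  of that event, and the slice bound controls the average.\<close>

lemma mean_bad_le:
  fixes S :: "(nat \<Rightarrow> bool) set" and \<tau> :: real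
  assumes S: "S \<subseteq> F2vec n" and t: "t \<le> 2 ^ a" and \<tau>: "\<tau> > 0"
    and big: "real (card S) / 2 ^ t \<ge> 8 * (1 + \<tau>) * (2 ^ a)\<^sup>2 / \<tau>\<^sup>2"
  defines "bad \<equiv> \<lambda>L. \<exists>y\<in>F2vec t.
    \<bar>real (card {x \<in> S. L x = y}) - real (card S) / 2 ^ t\<bar> > \<tau> * (real (card S) / 2 ^ t)"
  shows "mean (F2linear n t) (\<lambda>L. of_bool (bad L)) \<le> 16 * 2 ^ a / (\<tau>\<^sup>2 * (real (card S) / 2 ^ t))"
proof -
  define m where "m = real (card S) / 2 ^ t"
  \<comment> \<open>A cell has mean m / 2^a, so \<open>d\<close> is a relative error of \<tau> /
    2.\<close>
  define d where "d = \<tau> * m / (2 * 2 ^ a)"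
  define dev where "dev = (\<lambda>L R (y :: nat \<Rightarrow> bool) (c :: nat \<Rightarrow> bool).
    d \<le> \<bar>real (card {x \<in> S. L x = y \<and> R x = c}) - real (card S) / 2 ^ (t + a)\<bar>)"
  define allbad where "allbad = (\<lambda>L R. \<exists>y\<in>F2vec t. \<forall>c\<in>F2vec a. dev L R y c)"
  have "0 < 8 * (1 + \<tau>) * (2 ^ a)\<^sup>2 / \<tau>\<^sup>2"
    using \<tau> by simp
  with big have m: "m > 0"
    unfolding m_def by linarith
  then have d: "d > 0" using \<tau> by (simp add: d_def)
  have "of_bool (bad L) \<le> 2 * mean (F2linear n a) (\<lambda>R. of_bool (allbad L R))"
    if L: "L \<in> F2linear n t" for L
  proof (cases "bad L")
    case True
    then obtain y where y: "y \<in> F2vec t" "\<bar>real (card {x \<in> S. L x = y}) - m\<bar> > \<tau> * m"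
      by (auto simp: bad_def m_def)
    define T where "T = {x \<in> S. L x = y}"
    define D where "D = \<bar>real (card T) - m\<bar>"
    \<comment> \<open>Half of the bucket's deviation per cell: one half is allowed for the
      fluctuation of \<open>R\<close>, the other half remains as the deviation from m / 2^a.\<close>
    define e where "e = D / (2 * 2 ^ a)"
    have D: "D > \<tau> * m" using y by (simp add: D_def T_def)
    then have D0: "D > 0" using \<tau> m by (meson less_trans mult_pos_pos)
    then have e: "e > 0" by (simp add: e_def)
    have "d \<le> e" using D by (simp add: d_def e_def divide_right_mono)
    \<comment> \<open>The bucket may be overfull, so its size is bounded through the deviation
      itself: \<tau> |T| \<le> (1 + \<tau>) D. With D > \<tau> m and the lower bound on m this gives
      8 * 4^a |T| \<le> D^2, which is the claim because e^2 = D^2 / (4 * 4^a).\<close>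
    have "2 * real (card T) \<le> e\<^sup>2"
    proof -
      have "\<tau> * real (card T) \<le> \<tau> * (m + D)"
        using \<tau> by (intro mult_left_mono) (auto simp: D_def)
      also have "\<dots> \<le> D * (1 + \<tau>)"
        using D by (simp add: algebra_simps)
      finally have T_le: "\<tau> * real (card T) \<le> D * (1 + \<tau>)" .
      have "8 * (1 + \<tau>) * (2 ^ a)\<^sup>2 \<le> \<tau> * (\<tau> * m)"
        using big \<tau> by (simp add: m_def [symmetric] pos_divide_le_eq power2_eq_square mult_ac)
      also have "\<dots> \<le> \<tau> * D"
        using D \<tau> by simp
      finally have "D * (8 * (1 + \<tau>) * (2 ^ a)\<^sup>2) \<le> D * (\<tau> * D)"
        using D0 by (intro mult_left_mono) auto
      moreover have "\<tau> * (8 * (2 ^ a)\<^sup>2 * real (card T)) \<le> D * (8 * (1 + \<tau>) * (2 ^ a)\<^sup>2)"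
      proof -
        have "8 * (2 ^ a)\<^sup>2 * (\<tau> * real (card T)) \<le> 8 * (2 ^ a)\<^sup>2 * (D * (1 + \<tau>))"
          by (intro mult_left_mono T_le) simp
        then show ?thesis by (simp only: mult_ac)
      qed
      ultimately have "\<tau> * (8 * (2 ^ a)\<^sup>2 * real (card T)) \<le> D * (\<tau> * D)"
        by (rule order_trans [rotated])
      then have "\<tau> * (8 * (2 ^ a)\<^sup>2 * real (card T)) \<le> \<tau> * D\<^sup>2"
        by (simp only: power2_eq_square mult_ac)
      then have "8 * (2 ^ a)\<^sup>2 * real (card T) \<le> D\<^sup>2"
        using \<tau> by simp
      then show ?thesis
        by (simp add: e_def power_divide power_mult_distrib le_divide_eq mult_ac)
    qed
    then have "real (card T) / e\<^sup>2 \<le> 1 / 2"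
      using e by (simp add: divide_le_eq)
    moreover have "T \<subseteq> F2vec n"
      using S by (auto simp: T_def)
    ultimately have half: "mean (F2linear n a)
        (\<lambda>R. of_bool (\<exists>c\<in>F2vec a. e \<le> \<bar>real (card {x \<in> T. R x = c}) - real (card T) / 2 ^ a\<bar>)) \<le> 1 / 2"
      using mean_ex_deviation_le [of T n e a] e by linarith
    have "1 - of_bool (\<exists>c\<in>F2vec a. e \<le> \<bar>real (card {x \<in> T. R x = c}) - real (card T) / 2 ^ a\<bar>)
        \<le> (of_bool (allbad L R) :: real)" for R
    proof -
      have "dev L R y c" if "\<bar>real (card {x \<in> T. R x = c}) - real (card T) / 2 ^ a\<bar> < e" for c
      proof -
        \<comment> \<open>The centres |T| / 2^a and m / 2^a are 2 e apart, so a cell within e of the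
          first is at least e, hence at least d, away from the second.\<close>
        have "\<bar>real (card T) / 2 ^ a - m / 2 ^ a\<bar> = 2 * e"
          by (simp add: e_def D_def flip: diff_divide_distrib)
        moreover have "{x \<in> T. R x = c} = {x \<in> S. L x = y \<and> R x = c}"
          by (auto simp: T_def)
        moreover have "real (card S) / 2 ^ (t + a) = m / 2 ^ a"
          by (simp add: m_def power_add)
        ultimately show ?thesis
          using that \<open>d \<le> e\<close> by (simp add: dev_def)
      qed
      then have "allbad L R"
        if "\<forall>c\<in>F2vec a. \<bar>real (card {x \<in> T. R x = c}) - real (card T) / 2 ^ a\<bar> < e"
        using that y(1) unfolding allbad_def by blast
      then show ?thesis
        by (auto simp: of_bool_def not_le)
    qed
    then have "mean (F2linear n a) (\<lambda>R. 1 -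
        of_bool (\<exists>c\<in>F2vec a. e \<le> \<bar>real (card {x \<in> T. R x = c}) - real (card T) / 2 ^ a\<bar>))
        \<le> mean (F2linear n a) (\<lambda>R. of_bool (allbad L R))"
      by (intro mean_mono)
    then have "1 - 1 / 2 \<le> mean (F2linear n a) (\<lambda>R. of_bool (allbad L R))"
      using half by (simp add: mean_diff)
    then show ?thesis
      using True by simp
  qed (simp add: mean_nonneg)
  then have "mean (F2linear n t) (\<lambda>L. of_bool (bad L))
      \<le> mean (F2linear n t) (\<lambda>L. 2 * mean (F2linear n a) (\<lambda>R. of_bool (allbad L R)))"
    by (rule mean_mono)
  also have "\<dots> = 2 * mean (F2linear n t) (\<lambda>L. mean (F2linear n a) (\<lambda>R. of_bool (allbad L R)))"
    by (rule mean_cmult)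
  also have "\<dots> \<le> 2 * (2 * real (card S) / (2 ^ (t + a) * d\<^sup>2))"
    unfolding allbad_def dev_def
    by (intro mult_left_mono mean_all_slices_deviate_le S t d) simp
  also have "\<dots> = 16 * 2 ^ a / (\<tau>\<^sup>2 * m)"
  proof -
    have "real (card S) = m * 2 ^ t" by (simp add: m_def)
    then show ?thesis
      using m \<tau> by (simp add: d_def power_add power2_eq_square field_simps)
  qed
  finally show ?thesis by (simp add: m_def)
qed

text \<open>The second bound on |S| / 2^t makes at most a fraction \<delta> / 2 of all linear maps
  bad. As t + 2 \<le> n makes at least half of them surjective, the bad maps number at most \<delta>
  times the surjective ones.\<close>

lemma card_close_surj_ge:
  fixes S :: "(nat \<Rightarrow> bool) set" and \<tau> \<delta> :: real
  assumes S: "S \<subseteq> F2vec n" and t: "t \<le> 2 ^ a" "t + 2 \<le> n" and \<tau>: "\<tau> > 0"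
    and big: "real (card S) / 2 ^ t \<ge> 8 * (1 + \<tau>) * (2 ^ a)\<^sup>2 / \<tau>\<^sup>2"
    and big': "real (card S) / 2 ^ t \<ge> 32 * 2 ^ a / (\<tau>\<^sup>2 * \<delta>)" and \<delta>: "\<delta> > 0"
  shows "real (card {L \<in> F2surj_linear n t.
      close_to_uniform (\<tau> * 2 powr (- real t)) (prob_image L S) (F2vec t)})
    \<ge> (1 - \<delta>) * real (card (F2surj_linear n t))"
proof -
  define m where "m = real (card S) / 2 ^ t"
  define bad where "bad = (\<lambda>L. \<exists>y\<in>F2vec t. \<bar>real (card {x \<in> S. L x = y}) - m\<bar> > \<tau> * m)"
  let ?G = "F2surj_linear n t" and ?A = "F2linear n t"
  let ?B = "{L \<in> ?A. bad L}"
  let ?C = "{L \<in> ?G. close_to_uniform (\<tau> * 2 powr (- real t)) (prob_image L S) (F2vec t)}"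
  have "0 < 32 * 2 ^ a / (\<tau>\<^sup>2 * \<delta>)"
    using \<tau> \<delta> by simp
  with big' have m: "m > 0"
    unfolding m_def by linarith
  then have cardS: "real (card S) = m * 2 ^ t" by (simp add: m_def)
  have GA: "?G \<subseteq> ?A" by (auto simp: F2surj_linear_def)
  have "real (card ?B) / real (card ?A) \<le> 16 * 2 ^ a / (\<tau>\<^sup>2 * m)"
    using mean_bad_le [OF S t(1) \<tau> big] by (simp add: mean_of_bool bad_def m_def)
  also have "\<dots> \<le> \<delta> / 2"
    using big' m \<tau> \<delta> by (simp add: m_def [symmetric] field_simps)
  finally have B: "real (card ?B) \<le> \<delta> * (real (card ?A) / 2)"
    by (simp add: divide_le_eq)
  have "real (card (?A - ?G)) \<le> 2 * 2 ^ t / 2 ^ n * real (card ?A)"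
    by (rule card_not_surj_le)
  also have "\<dots> \<le> 1 / 2 * real (card ?A)"
  proof (rule mult_right_mono)
    have "(2::real) ^ (t + 2) \<le> 2 ^ n"
      using t(2) by (intro power_increasing) auto
    then show "2 * 2 ^ t / 2 ^ n \<le> (1 / 2 :: real)"
      by (simp add: divide_le_eq)
  qed simp
  finally have "real (card ?A) / 2 \<le> real (card ?G)"
    using card_Diff_subset [OF finite_subset [OF GA] GA] card_mono [OF _ GA] by (simp add: of_nat_diff)
  then have "\<delta> * (real (card ?A) / 2) \<le> \<delta> * real (card ?G)"
    using \<delta> by (intro mult_left_mono) auto
  with B have "real (card ?B) \<le> \<delta> * real (card ?G)" by linarith
  moreover have "?G \<subseteq> ?C \<union> ?B"
  proof -
    have "close_to_uniform (\<tau> * 2 powr (- real t)) (prob_image L S) (F2vec t)" if "\<not> bad L" for L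
      unfolding close_to_uniform_def
    proof
      fix y assume "y \<in> F2vec t"
      then have y: "\<bar>real (card {x \<in> S. L x = y}) - m\<bar> \<le> \<tau> * m"
        using that by (auto simp: bad_def not_less)
      have "\<bar>prob_image L S y - 1 / real (card (F2vec t))\<bar>
          = \<bar>real (card {x \<in> S. L x = y}) - m\<bar> / (m * 2 ^ t)"
      proof -
        have "prob_image L S y - 1 / real (card (F2vec t)) = (real (card {x \<in> S. L x = y}) - m) / (m * 2 ^ t)"
          using m by (simp add: prob_image_def cardS field_simps)
        then show ?thesis using m by (simp add: abs_mult)
      qed
      also have "\<dots> \<le> \<tau> * m / (m * 2 ^ t)"
        using m by (intro divide_right_mono y) simp
      also have "\<dots> = \<tau> * 2 powr (- real t)"
        using m by (simp add: powr_minus powr_realpow divide_inverse)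
      finally show "\<bar>prob_image L S y - 1 / real (card (F2vec t))\<bar> \<le> \<tau> * 2 powr (- real t)" .
    qed
    then show ?thesis using GA by auto
  qed
  then have "card ?G \<le> card (?C \<union> ?B)"
    using GA by (intro card_mono) (auto intro: finite_subset [OF _ finite_F2linear])
  then have "real (card ?G) \<le> real (card ?C) + real (card ?B)"
    using card_Un_le [of ?C ?B] by linarith
  ultimately show ?thesis
    by (simp add: left_diff_distrib)
qed

section \<open>Choice of the parameters\<close>

lemma ex_power2_between:
  assumes "n > 0"
  shows "\<exists>a. n \<le> 2 ^ a \<and> 2 ^ a \<le> 2 * (n :: nat)"
proof -
  define a where "a = (LEAST a. n \<le> 2 ^ a)"
  have "n \<le> 2 ^ n" using less_exp [of n] by simp
  then have a: "n \<le> 2 ^ a" unfolding a_def by (rule LeastI)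
  show ?thesis
  proof (cases a)
    case 0
    then show ?thesis using a assms by (intro exI [of _ a]) auto
  next
    case (Suc b)
    then have "\<not> n \<le> 2 ^ b" unfolding a_def by (intro not_less_Least) simp
    then show ?thesis using a Suc by (intro exI [of _ a]) auto
  qed
qed

theorem mainTheorem2:
  fixes n :: nat and \<tau> \<delta> :: real and S :: "(nat \<Rightarrow> bool) set"
  assumes "n > 0" and "\<tau> > 0" and "0 < \<delta>" and "\<delta> < 1"
    and "S \<subseteq> F2vec n"
    and "real (card S) > 2 ^ 20 * max ((real n) ^ 4 * (1 + \<tau>) ^ 4 / (\<tau> * \<delta>) ^ 8) ((real n) ^ 4)"
    and "real n \<ge> 5 * real_of_int \<lceil>log 2 (max (real n * (1 + \<tau>) / (\<tau> * \<delta>) ^ 2) (real n))\<rceil> + 25"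
  shows "\<exists>t::nat. t \<le> n \<and>
     real t \<ge> log 2 (real (card S)) - 4 * log 2 (max (real n * (1 + \<tau>) / (\<tau> * \<delta>) ^ 2) (real n)) - 20 \<and>
     real (card {L \<in> F2surj_linear n t. close_to_uniform (\<tau> * 2 powr (- real t)) (prob_image L S) (F2vec t)})
       \<ge> (1 - \<delta>) * real (card (F2surj_linear n t))"
proof -
  define M where "M = max (real n * (1 + \<tau>) / (\<tau> * \<delta>) ^ 2) (real n)"
  define K where "K = log 2 (real (card S)) - 4 * log 2 M - 20"
  \<comment> \<open>The least integer satisfying the required bound; \<open>nat\<close> truncates
    nothing, as K > 0 is shown below. Rounding costs a factor of at most 2, hence 2^19 instead of
    2^20 in the bound on \<open>m\<close>.\<close>
  define t where "t = nat \<lceil>K\<rceil>"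
  define m where "m = real (card S) / 2 ^ t"
  have M: "M \<ge> real n" "M \<ge> real n * (1 + \<tau>) / (\<tau> * \<delta>) ^ 2"
    by (simp_all add: M_def)
  have M1: "M \<ge> 1" using M(1) assms(1) by linarith
  have M4: "max ((real n) ^ 4 * (1 + \<tau>) ^ 4 / (\<tau> * \<delta>) ^ 8) ((real n) ^ 4) = M ^ 4"
  proof -
    have "(real n * (1 + \<tau>) / (\<tau> * \<delta>) ^ 2) ^ 4 = (real n) ^ 4 * (1 + \<tau>) ^ 4 / (\<tau> * \<delta>) ^ 8"
      by (simp add: power_divide power_mult_distrib flip: power_mult)
    moreover have "(max x y) ^ 4 = max (x ^ 4) (y ^ 4)" if "x \<ge> 0" "y \<ge> 0" for x y :: real
      using that by (auto simp: max_def power_mono dest: power_le_imp_le_base intro: antisym power_mono)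
    ultimately show ?thesis
      using assms(2) by (simp add: M_def)
  qed
  have S_gt: "real (card S) > 2 ^ 20 * M ^ 4"
    using assms(6) unfolding M4 .
  have S0: "real (card S) > 0"
    using S_gt M1 by (smt (verit) zero_less_power mult_pos_pos)
  have K: "2 powr K = real (card S) / (2 ^ 20 * M ^ 4)"
  proof -
    have "2 powr (4 * log 2 M) = M ^ 4"
      using M1 powr_powr [of 2 "log 2 M" 4] by (simp add: mult.commute powr_numeral)
    moreover have "2 powr (20 :: real) = 2 ^ 20"
      by (simp add: powr_numeral)
    ultimately show ?thesis
      using S0 by (simp add: K_def powr_diff)
  qed
  have "2 powr K > 2 powr 0"
    unfolding K using S_gt M1 by (simp add: less_divide_eq)
  then have "K > 0" by (rule powr_less_cancel) simp
  then have t_eq: "real t = real_of_int \<lceil>K\<rceil>" by (simp add: t_def)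
  then have t: "K \<le> real t" "real t < K + 1" by linarith+
  have "(2::real) ^ t = 2 powr real t" by (simp add: powr_realpow)
  also have "\<dots> < 2 powr (K + 1)" using t by simp
  also have "\<dots> = 2 * (real (card S) / (2 ^ 20 * M ^ 4))"
    by (simp add: powr_add K)
  finally have m: "2 ^ 19 * M ^ 4 < m"
    using M1 by (simp add: m_def field_simps)
  \<comment> \<open>Counting gives 2^(t + 2) \<le> |S| \<le> 2^n, hence the room of two dimensions
    that surjectivity asks for.\<close>
  have "card S \<le> 2 ^ n"
    using card_mono [OF finite_F2vec assms(5)] by simp
  then have "real (card S) \<le> 2 ^ n"
    by (metis of_nat_le_iff of_nat_numeral of_nat_power)
  moreover have "4 \<le> m" using m one_le_power [OF M1, of 4] by simp
  then have "2 ^ (t + 2) \<le> real (card S)"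
    by (simp add: m_def le_divide_eq)
  ultimately have "(2::real) ^ (t + 2) \<le> 2 ^ n" by linarith
  then have tn: "t + 2 \<le> n" by (simp only: power_increasing_iff one_less_numeral_iff semiring_norm)
  \<comment> \<open>The bound n \<le> 2^a ensures t \<le> 2^a for the slice induction, and 2^a \<le>
    2 n keeps the number of cells per bucket linear in n.\<close>
  obtain a where a: "n \<le> 2 ^ a" "2 ^ a \<le> 2 * n"
    using ex_power2_between [OF assms(1)] by blast
  have a2: "(2::real) ^ a \<le> 2 * real n"
    using a(2) by (metis of_nat_le_iff of_nat_mult of_nat_numeral of_nat_power)
  have \<delta>2: "\<delta>\<^sup>2 \<le> 1" "\<delta>\<^sup>2 \<le> \<delta>"
    using assms by (simp_all add: power_le_one power2_eq_square mult_le_one mult_left_le)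
  \<comment> \<open>Both size conditions reduce to powers of M: this one uses \<delta>^2 \<le> 1,
    the next one \<delta>^2 \<le> \<delta> and 1 \<le> 1 + \<tau>. They become 32 M^2 \<le> m and 64
    M \<le> m, both covered by 2^19 M^4 < m.\<close>
  have n\<tau>: "real n * (1 + \<tau>) / \<tau>\<^sup>2 \<le> M"
  proof -
    have "real n * (1 + \<tau>) / \<tau>\<^sup>2 \<le> real n * (1 + \<tau>) / (\<tau> * \<delta>) ^ 2"
      using assms \<delta>2 by (intro divide_left_mono) (auto simp: power_mult_distrib mult_left_le)
    then show ?thesis using M by linarith
  qed
  have n\<delta>: "real n / (\<tau>\<^sup>2 * \<delta>) \<le> M"
  proof -
    have "real n / (\<tau>\<^sup>2 * \<delta>) \<le> real n * (1 + \<tau>) / (\<tau> * \<delta>) ^ 2"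
      using assms \<delta>2 by (intro frac_le) (auto simp: power_mult_distrib)
    then show ?thesis using M by linarith
  qed
  have M24: "M\<^sup>2 \<le> M ^ 4" "M \<le> M ^ 4"
    using M1 power_increasing [of 2 4 M] power_increasing [of 1 4 M] by simp_all
  have "8 * (1 + \<tau>) * (2 ^ a)\<^sup>2 / \<tau>\<^sup>2 \<le> 8 * (1 + \<tau>) * (2 * real n)\<^sup>2 / \<tau>\<^sup>2"
    using a2 assms(2) by (intro divide_right_mono mult_left_mono power_mono) auto
  also have "\<dots> = 32 * (real n * (real n * (1 + \<tau>) / \<tau>\<^sup>2))"
    by (simp add: power2_eq_square)
  also have "\<dots> \<le> 32 * (M * M)"
    using M(1) M1 n\<tau> assms(2) by (intro mult_left_mono mult_mono) auto
  also have "\<dots> \<le> m"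
    using M24 m M1 by (simp add: power2_eq_square)
  finally have big: "8 * (1 + \<tau>) * (2 ^ a)\<^sup>2 / \<tau>\<^sup>2 \<le> m" .
  have "32 * 2 ^ a / (\<tau>\<^sup>2 * \<delta>) \<le> 32 * (2 * real n) / (\<tau>\<^sup>2 * \<delta>)"
    using a2 assms(2,3) by (intro divide_right_mono mult_left_mono) auto
  also have "\<dots> \<le> 64 * M" using n\<delta> by simp
  also have "\<dots> \<le> m" using M24(2) m M1 by simp
  finally have big': "32 * 2 ^ a / (\<tau>\<^sup>2 * \<delta>) \<le> m" .
  show ?thesis
  proof (intro exI [of _ t] conjI)
    show "t \<le> n" using tn by simp
    show "real t \<ge> log 2 (real (card S)) - 4 * log 2 (max (real n * (1 + \<tau>) / (\<tau> * \<delta>) ^ 2) (real n)) - 20"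
      using t(1) by (simp only: K_def M_def)
    show "real (card {L \<in> F2surj_linear n t. close_to_uniform (\<tau> * 2 powr (- real t)) (prob_image L S) (F2vec t)})
       \<ge> (1 - \<delta>) * real (card (F2surj_linear n t))"
      using card_close_surj_ge [OF assms(5) _ tn assms(2) big [unfolded m_def] big' [unfolded m_def] assms(3)]
        a(1) tn by simp
  qed
qed

end
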